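(* Consider self-improvement with supervised fine-tuning (SFT) of the generation branch of a unified multimodal model, and at epoch $t$ let $\theta_{t+1}$ be obtained from $\theta_t$ by one SFT gradient step with learning rate $\eta$ on a post-training pair $(\mathbf y_u,\mathbf x_u)$. Let $(\mathbf y_0,\mathbf x_0)$ be an evaluation (prompt, image) pair. (i) The one-step learning dynamics of generation, $\Delta G_t(\mathbf x_0\mid\mathcal Y_0):=\log\pi_{\theta_{t+1}}(\mathbf x_0\mid\mathcal Y_0)-\log\pi_{\theta_t}(\mathbf x_0\mid\mathcal Y_0)$, is $$\Delta G_t(\mathbf x_0\mid\mathcal Y_0)=-\eta\sum_{k=1}^{M}\sum_{r=1}^{M}(\mathbf e_{x_{0,k}}-\pi^0_k)^\top\,\mathcal K^t_{k,r}(\mathcal Y_0,\mathcal Y_u)\,(\pi^u_r-\mathbf e_{x_{u,r}})+\mathcal O(\eta^2),$$ where $\pi^u_r=\mathrm{softmax}(\mathbf z^u_r)$, $\mathbf z^u_r=[h_\theta(\mathcal Y_u)]_r$ are the logits at image position $r$ obtained by running $h_\theta$ on $\mathcal Y_u$, and $\mathcal K^t_{k,r}(\mathcal Y_0,\mathcal Y_u):=(\nabla_{\theta_t}\mathbf z^0_k)(\nabla_{\theta_t}\mathbf z^u_r)^\top\in\mathbb R^{V\times V}$ is the empirical neural tangent kernel. (ii) The one-step learning dynamics of understanding, $\Delta U_t(\mathbf y_0\mid\mathcal X_0):=\log\pi_{\theta_{t+1}}(\mathbf y_0\mid\mathcal X_0)-\log\pi_{\theta_t}(\mathbf y_0\mid\mathcal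 X_0)$, is $$\Delta U_t(\mathbf y_0\mid\mathcal X_0)=-\eta\sum_{k=1}^{M}\sum_{r=1}^{M}\sum_{\mathbf y_i\ne\mathbf y_0}w_{\theta_t}(\mathbf y_i\mid\mathbf x_0)\Big((\mathbf e_{x_{0,k}}-\pi^0_k)^\top\mathcal K^t_{k,r}(\mathcal Y_0,\mathcal Y_u)-(\mathbf e_{x_{0,k}}-\pi^i_k)^\top\mathcal K^t_{k,r}(\mathcal Y_i,\mathcal Y_u)\Big)(\pi^u_r-\mathbf e_{x_{u,r}})+\mathcal O(\eta^2),$$ where $w_{\theta_t}(\mathbf y\mid\mathbf x_0):=\pi_{\theta_t}(\mathbf x_0\mid\mathbf y)\big/\sum_{\mathbf y'}\pi_{\theta_t}(\mathbf x_0\mid\mathbf y')$ and $\mathcal Y_i$ denotes the concatenation of a prompt $\mathbf y_i\neq\mathbf y_0$ and $\mathbf x_0$.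
   Context: Setting. A unified multimodal model $\pi_\theta$ has a generation branch (prompt to image) and an understanding branch (image to text), which share the same tokenizer and the same logits network $h_\theta$. Self-improvement with SFT: for a prompt, the model generates candidate images, its own understanding branch judges which of them match the prompt, and images judged to match give post-training pairs $(\mathbf y_u,\mathbf x_u)$ on which the generation branch is fine-tuned. Tokens. $\mathcal V$ is the unified vocabulary of text and image tokens, $V=|\mathcal V|$; $\mathbf e_v\in\mathbb R^V$ is the standard basis vector indexed by $v\in\mathcal V$. An image is a token sequence of length $M$, e.g. $\mathbf x_0=(x_{0,1},\dots,x_{0,M})$, $\mathbf x_u=(x_{u,1},\dots,x_{u,M})$; a prompt is a token sequence, e.g. $\mathbf y_0=(y_{0,1},\dots,y_{0,L})$ (prompt length may vary). Prompts are taken to follow a uniform distribution; sums over $\mathbf y_i$ and $\mathbf y'$ are over prompts. Model. With standard causal masking, the generation input is $\mathcal Y_0=[\mathbf y_0\mid\mathbf x_0]$ (embeddings of the prompt followed by those of the image) and the understanding input is $\mathcal X_0=[\mathbf x_0\mid\mathbf y_0]$ (the other order); similarly $\mathcal Y_u=[\mathbf y_u\mid\mathbf x_u]$ and $\mathcal Y_i=[\mathbf y_i\mid\mathbf x_0]$. The logits network $h_\theta$ outputs $\mathbf z^0_{\rm gen}\in\mathbb R^{V\times M}$, the columns of $h_\theta(\mathcal Y_0)$ at the $M$ image positions, and $\mathbf z^0_{\rm und}\in\mathbb R^{V\times L}$, the columns of $h_\theta(\mathcal X_0)$ at the $L$ text positions. The likelihoods are $$\pi_\theta(\mathbf x_0\mid\mathcal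 Y_0)=\pi_\theta(\mathbf x_0\mid\mathbf y_0)=\prod_{k=1}^M\pi_\theta(x_{0,k}\mid\mathbf y_0,\mathbf x_{0,<k})=\prod_{k=1}^M[\mathrm{softmax}(\mathbf z^0_{\rm gen})]_{x_{0,k},k},$$ $$\pi_\theta(\mathbf y_0\mid\mathcal X_0)=\pi_\theta(\mathbf y_0\mid\mathbf x_0)=\prod_{\ell=1}^L\pi_\theta(y_{0,\ell}\mid\mathbf x_0,\mathbf y_{0,<\ell})=\prod_{\ell=1}^L[\mathrm{softmax}(\mathbf z^0_{\rm und})]_{y_{0,\ell},\ell},$$ with softmax applied column-wise. SFT step. $\theta_{t+1}=\theta_t-\eta\nabla_\theta\mathcal L_{\rm SFT}(\mathcal Y_u)$ (gradient at $\theta_t$), with $\mathcal L_{\rm SFT}(\mathcal Y_u)=-\sum_{r=1}^M\log[\pi^u_r]_{x_{u,r}}$. Notation at $\theta=\theta_t$. $\mathbf z^0_k$ and $\mathbf z^i_k$ are the logit vectors in $\mathbb R^V$ at image position $k$ obtained from $\mathcal Y_0$ and $\mathcal Y_i$; $\pi^0_k=\mathrm{softmax}(\mathbf z^0_k)$, $\pi^i_k=\mathrm{softmax}(\mathbf z^i_k)$; $\nabla_{\theta}\mathbf z$ is the Jacobian of $\mathbf z$ in $\theta$ (with $V$ rows); $\mathcal K^t_{k,r}(\mathcal Y_i,\mathcal Y_u)=(\nabla_{\theta_t}\mathbf z^i_k)(\nabla_{\theta_t}\mathbf z^u_r)^\top$.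
   Formalization: Logits are assumed twice differentiable at θ_t (implicit in the O(η²) claim); part (ii) also assumes that, for θ near θ_t, both branches are conditionals of one joint (prompt, image) law with uniform prompt marginal on a finite prompt set; (ii) fails for unrelated branches. *)

theory Defs
  imports "HOL-Probability.Probability" "HOL-Library.Landau_Symbols"
begin

text \<open>
  The vocabulary is the finite type \<open>'v\<close>, parameters live in \<open>real^'p\<close>, and prompts and images
  are token lists.  \<open>h \<theta> s j\<close> is the column of the logits matrix of the network with parameters
  \<open>\<theta>\<close> at position \<open>j\<close> (counted from \<open>0\<close>) of the input sequence \<open>s\<close>; the token embedding is part
  of \<open>h\<close>.
\<close>

type_synonym ('p, 'v) network = "real^'p \<Rightarrow> 'v list \<Rightarrow> nat \<Rightarrow> real^'v"

text \<open>
  The column at position \<open>j\<close> predicts the token at position \<open>j\<close> from the tokens strictly before it,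
  so that it does not depend on the token at position \<open>j\<close> itself.
\<close>

definition causal :: "('p::finite, 'v::finite) network \<Rightarrow> bool" where
  "causal h \<longleftrightarrow> (\<forall>\<theta> s s' j. j < length s \<longrightarrow> j < length s' \<longrightarrow> take j s = take j s'
     \<longrightarrow> h \<theta> s j = h \<theta> s' j)"

definition softmax :: "real^'v \<Rightarrow> real^'v::finite" where
  "softmax z = (\<chi> v. exp (z $ v) / (\<Sum>w\<in>UNIV. exp (z $ w)))"

definition gen_logits ::
  "('p::finite, 'v::finite) network \<Rightarrow> real^'p \<Rightarrow> 'v list \<Rightarrow> 'v list \<Rightarrow> nat \<Rightarrow> real^'v" where
  "gen_logits h \<theta> y x k = h \<theta> (y @ x) (length y + k)"

definition und_logits ::
  "('p::finite, 'v::finite) network \<Rightarrow> real^'p \<Rightarrow> 'v list \<Rightarrow> 'v list \<Rightarrow> nat \<Rightarrow> real^'v" where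
  "und_logits h \<theta> x y l = h \<theta> (x @ y) (length x + l)"

text \<open>\<open>gen_lik h \<theta> y x\<close> is \<open>\<pi>\<^sub>\<theta>(x | y)\<close> and \<open>und_lik h \<theta> x y\<close> is \<open>\<pi>\<^sub>\<theta>(y | x)\<close>.\<close>

definition gen_lik ::
  "('p::finite, 'v::finite) network \<Rightarrow> real^'p \<Rightarrow> 'v list \<Rightarrow> 'v list \<Rightarrow> real" where
  "gen_lik h \<theta> y x = (\<Prod>k<length x. softmax (gen_logits h \<theta> y x k) $ (x ! k))"

definition und_lik ::
  "('p::finite, 'v::finite) network \<Rightarrow> real^'p \<Rightarrow> 'v list \<Rightarrow> 'v list \<Rightarrow> real" where
  "und_lik h \<theta> x y = (\<Prod>l<length y. softmax (und_logits h \<theta> x y l) $ (y ! l))"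

text \<open>
  The two branches are the two conditionals of one joint distribution of prompts and images of
  length \<open>M\<close> whose prompt marginal is uniform on \<open>P\<close>.
\<close>

definition coherent_branches ::
  "('p::finite, 'v::finite) network \<Rightarrow> nat \<Rightarrow> 'v list set \<Rightarrow> real^'p \<Rightarrow> bool" where
  "coherent_branches h M P \<theta> \<longleftrightarrow>
     (\<exists>J :: ('v list \<times> 'v list) pmf.
        map_pmf fst J = pmf_of_set P \<and>
        (\<forall>y\<in>P. \<forall>x. length x = M \<longrightarrow>
           pmf J (y, x) = pmf (map_pmf fst J) y * gen_lik h \<theta> y x \<and>
           pmf J (y, x) = pmf (map_pmf snd J) x * und_lik h \<theta> x y))"

definition gradient :: "(real^'p \<Rightarrow> real) \<Rightarrow> real^'p \<Rightarrow> real^'p::finite" where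
  "gradient f \<theta> = (THE D. GDERIV f \<theta> :> D)"

definition twice_differentiable_at :: "(real^'p::finite \<Rightarrow> real^'v::finite) \<Rightarrow> real^'p \<Rightarrow> bool" where
  "twice_differentiable_at f \<theta> \<longleftrightarrow>
     (\<forall>\<^sub>F \<theta>' in nhds \<theta>. f differentiable (at \<theta>')) \<and>
     (\<lambda>\<theta>'. jacobian f (at \<theta>')) differentiable (at \<theta>)"

definition sft_loss ::
  "('p::finite, 'v::finite) network \<Rightarrow> 'v list \<Rightarrow> 'v list \<Rightarrow> real^'p \<Rightarrow> real" where
  "sft_loss h y x \<theta> = - (\<Sum>r<length x. ln (softmax (gen_logits h \<theta> y x r) $ (x ! r)))"

definition sft_step ::
  "('p::finite, 'v::finite) network \<Rightarrow> 'v list \<Rightarrow> 'v list \<Rightarrow> real \<Rightarrow> real^'p \<Rightarrow> real^'p" where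
  "sft_step h y x \<eta> \<theta> = \<theta> - \<eta> *\<^sub>R gradient (sft_loss h y x) \<theta>"

definition delta_gen ::
  "('p::finite, 'v::finite) network \<Rightarrow> real^'p \<Rightarrow> real^'p \<Rightarrow> 'v list \<Rightarrow> 'v list \<Rightarrow> real" where
  "delta_gen h \<theta> \<theta>' y x = ln (gen_lik h \<theta>' y x) - ln (gen_lik h \<theta> y x)"

definition delta_und ::
  "('p::finite, 'v::finite) network \<Rightarrow> real^'p \<Rightarrow> real^'p \<Rightarrow> 'v list \<Rightarrow> 'v list \<Rightarrow> real" where
  "delta_und h \<theta> \<theta>' x y = ln (und_lik h \<theta>' x y) - ln (und_lik h \<theta> x y)"

text \<open>
  The empirical neural tangent kernel between image position \<open>k\<close> of \<open>y @ x\<close> and image position \<open>r\<close>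
  of \<open>y' @ x'\<close>.
\<close>

definition entk ::
  "('p::finite, 'v::finite) network \<Rightarrow> real^'p \<Rightarrow> 'v list \<Rightarrow> 'v list \<Rightarrow> nat
     \<Rightarrow> 'v list \<Rightarrow> 'v list \<Rightarrow> nat \<Rightarrow> real^'v^'v" where
  "entk h \<theta> y x k y' x' r =
     jacobian (\<lambda>\<theta>. gen_logits h \<theta> y x k) (at \<theta>) **
     transpose (jacobian (\<lambda>\<theta>. gen_logits h \<theta> y' x' r) (at \<theta>))"

definition prompt_weight ::
  "('p::finite, 'v::finite) network \<Rightarrow> 'v list set \<Rightarrow> real^'p \<Rightarrow> 'v list \<Rightarrow> 'v list \<Rightarrow> real" where
  "prompt_weight h P \<theta> x y = gen_lik h \<theta> y x / (\<Sum>y'\<in>P. gen_lik h \<theta> y' x)"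

end

theory Submission
  imports Defs
begin

text \<open>
  The log-likelihood of an image is a sum of terms \<open>z\<^sub>v - ln (\<Sum>\<^sub>w exp z\<^sub>w)\<close>, with gradient
  \<open>(e\<^sub>v - \<pi>)\<^sup>T \<nabla>z\<close> in the parameters. Taylor expansion along the gradient step therefore pairs the
  gradient of the evaluated log-likelihood with that of the training log-likelihood, and this pairing
  is a sum of tangent kernels. For the understanding branch, the uniform prompt marginal and Bayes'
  rule give \<open>ln \<pi>(y\<^sub>0|x\<^sub>0) = ln \<pi>(x\<^sub>0|y\<^sub>0) - ln (\<Sum>\<^sub>y \<pi>(x\<^sub>0|y))\<close> near \<open>\<theta>\<close>. The second term is again
  a log-sum-exp, whose gradient is the average of those of \<open>ln \<pi>(x\<^sub>0|y)\<close> with weights \<open>w(y|x\<^sub>0)\<close>;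
  as the weights sum to one, the term \<open>y = y\<^sub>0\<close> cancels.
\<close>

definition has_smooth_gradient ::
  "('a::real_inner \<Rightarrow> real) \<Rightarrow> ('a \<Rightarrow> 'a) \<Rightarrow> 'a \<Rightarrow> bool" where
  "has_smooth_gradient f g x \<longleftrightarrow>
     (\<forall>\<^sub>F x' in nhds x. GDERIV f x' :> g x') \<and> g differentiable (at x)"

lemma has_smooth_gradient_GDERIV:
  "has_smooth_gradient f g x \<Longrightarrow> GDERIV f x :> g x"
  unfolding has_smooth_gradient_def by (blast dest: eventually_nhds_x_imp_x)

lemma gradient_eqI:
  assumes "GDERIV f x :> D"
  shows "gradient f x = D"
  unfolding gradient_def
proof (rule the_equality)
  fix D' assume "GDERIV f x :> D'"
  hence "(\<lambda>h. h \<bullet> D') = (\<lambda>h. h \<bullet> D)"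
    using assms unfolding gderiv_def by (rule has_derivative_unique)
  thus "D' = D"
    by (metis inner_commute vector_eq_ldot)
qed (fact assms)

lemma has_smooth_gradient_diff:
  assumes "has_smooth_gradient f g x" "has_smooth_gradient f' g' x"
  shows "has_smooth_gradient (\<lambda>x. f x - f' x) (\<lambda>x. g x - g' x) x"
  using assms unfolding has_smooth_gradient_def
  by (auto intro: differentiable_diff GDERIV_diff eventually_mono[OF eventually_conj])

lemma has_smooth_gradient_sum:
  assumes "finite I" "\<And>i. i \<in> I \<Longrightarrow> has_smooth_gradient (f i) (g i) x"
  shows "has_smooth_gradient (\<lambda>x. \<Sum>i\<in>I. f i x) (\<lambda>x. \<Sum>i\<in>I. g i x) x"
proof -
  have "\<forall>\<^sub>F x' in nhds x. \<forall>i\<in>I. GDERIV (f i) x' :> g i x'"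
    using assms by (intro eventually_ball_finite) (auto simp: has_smooth_gradient_def)
  hence "\<forall>\<^sub>F x' in nhds x. GDERIV (\<lambda>x. \<Sum>i\<in>I. f i x) x' :> (\<Sum>i\<in>I. g i x')"
    by eventually_elim
       (auto simp: gderiv_def inner_sum_right intro!: has_derivative_sum)
  moreover have "(\<lambda>x. \<Sum>i\<in>I. g i x) differentiable (at x)"
    using assms by (intro differentiable_sum) (auto simp: has_smooth_gradient_def)
  ultimately show ?thesis
    by (simp add: has_smooth_gradient_def)
qed

lemma GDERIV_ln_sum_exp:
  assumes "finite I" "I \<noteq> {}" "\<And>i. i \<in> I \<Longrightarrow> GDERIV (f i) x :> g i"
  shows "GDERIV (\<lambda>x. ln (\<Sum>i\<in>I. exp (f i x))) x :>
    (\<Sum>i\<in>I. (exp (f i x) / (\<Sum>j\<in>I. exp (f j x))) *\<^sub>R g i)"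
proof -
  have pos: "(\<Sum>i\<in>I. exp (f i x)) > 0"
    using assms by (intro sum_pos) auto
  show ?thesis
    using assms(3) pos unfolding gderiv_def
    by (auto intro!: derivative_eq_intros simp: fun_eq_iff inner_sum_right sum_distrib_left
        sum_divide_distrib field_simps)
qed

lemma has_smooth_gradient_ln_sum_exp:
  assumes fin: "finite I" and ne: "I \<noteq> {}"
    and f: "\<And>i. i \<in> I \<Longrightarrow> has_smooth_gradient (f i) (g i) x"
  shows "has_smooth_gradient (\<lambda>x. ln (\<Sum>i\<in>I. exp (f i x)))
    (\<lambda>x. \<Sum>i\<in>I. (exp (f i x) / (\<Sum>j\<in>I. exp (f j x))) *\<^sub>R g i x) x"
proof -
  have "\<forall>\<^sub>F x' in nhds x. \<forall>i\<in>I. GDERIV (f i) x' :> g i x'"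
    using fin f by (intro eventually_ball_finite) (auto simp: has_smooth_gradient_def)
  hence "\<forall>\<^sub>F x' in nhds x. GDERIV (\<lambda>x. ln (\<Sum>i\<in>I. exp (f i x))) x' :>
      (\<Sum>i\<in>I. (exp (f i x') / (\<Sum>j\<in>I. exp (f j x'))) *\<^sub>R g i x')"
    by eventually_elim (auto intro!: GDERIV_ln_sum_exp fin ne)
  moreover have "(\<lambda>x. \<Sum>i\<in>I. (exp (f i x) / (\<Sum>j\<in>I. exp (f j x))) *\<^sub>R g i x) differentiable (at x)"
  proof -
    have exp_f: "(\<lambda>x. exp (f i x)) differentiable (at x)" if "i \<in> I" for i
      using has_smooth_gradient_GDERIV[OF f[OF that]] unfolding gderiv_def differentiable_def
      by (blast intro: derivative_intros)
    have pos: "(\<Sum>i\<in>I. exp (f i x)) > 0"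
      using fin ne by (intro sum_pos) auto
    show ?thesis
      using fin f exp_f pos
      by (intro differentiable_sum differentiable_scaleR differentiable_divide)
         (auto simp: has_smooth_gradient_def)
  qed
  ultimately show ?thesis
    by (simp add: has_smooth_gradient_def)
qed

lemma has_smooth_gradient_taylor:
  assumes "has_smooth_gradient f g x"
  shows "(\<lambda>\<eta>. f (x - \<eta> *\<^sub>R d) - f x - (- \<eta> * (g x \<bullet> d))) \<in> O[at 0](\<lambda>\<eta>. \<eta>\<^sup>2)"
proof -
  from assms obtain r where r: "r > 0" and
    deriv: "\<And>x'. dist x' x < r \<Longrightarrow> GDERIV f x' :> g x'"
    by (auto simp: has_smooth_gradient_def eventually_nhds_metric)
  obtain C s where s: "s > 0" and
    lip: "\<And>x'. dist x' x < s \<Longrightarrow> norm (g x' - g x) \<le> C * norm (x' - x)"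
  proof -
    from assms obtain g' where g': "(g has_derivative g') (at x)"
      by (auto simp: has_smooth_gradient_def differentiable_def)
    then obtain B where B: "\<And>v. norm (g' v) \<le> norm v * B"
      using bounded_linear.bounded has_derivative_bounded_linear by blast
    from g' obtain s where s: "s > 0" and
      *: "\<And>x'. norm (x' - x) < s \<Longrightarrow> norm (g x' - g x - g' (x' - x)) \<le> 1 * norm (x' - x)"
      unfolding has_derivative_at_alt by (meson zero_less_one)
    show ?thesis
    proof (rule that[OF s])
      fix x' assume "dist x' x < s"
      hence "norm (g x' - g x - g' (x' - x)) \<le> norm (x' - x)"
        using * by (simp add: dist_norm)
      moreover have "norm (g' (x' - x)) \<le> norm (x' - x) * B"
        by (rule B)
      moreover have "norm (g x' - g x) \<le> norm (g x' - g x - g' (x' - x)) + norm (g' (x' - x))"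
        by (metis diff_add_cancel norm_triangle_ineq)
      ultimately show "norm (g x' - g x) \<le> (1 + B) * norm (x' - x)"
        by (simp add: algebra_simps)
    qed
  qed
  have "((\<lambda>\<eta>. norm (\<eta> *\<^sub>R d)) \<longlongrightarrow> norm (0 *\<^sub>R d)) (at 0)"
    by (intro tendsto_intros)
  hence "\<forall>\<^sub>F \<eta> in at 0. norm (\<eta> *\<^sub>R d) < min r s"
    using r s by (intro order_tendstoD(2)) auto
  hence "\<forall>\<^sub>F \<eta> in at 0. norm (f (x - \<eta> *\<^sub>R d) - f x - (- \<eta> * (g x \<bullet> d)))
      \<le> (\<bar>C\<bar> * (norm d)\<^sup>2) * norm (\<eta>\<^sup>2)"
  proof eventually_elim
    case (elim \<eta>)
    define \<rho> where "\<rho> = norm (\<eta> *\<^sub>R d)"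
    have near: "dist x' x < r" "dist x' x < s" if "x' \<in> cball x \<rho>" for x'
      using that elim by (auto simp: \<rho>_def dist_commute)
    have "norm (f (x - \<eta> *\<^sub>R d) - f x - (x - \<eta> *\<^sub>R d - x) \<bullet> g x)
        \<le> norm (x - \<eta> *\<^sub>R d - x) * (\<bar>C\<bar> * \<rho>)"
    proof (rule differentiable_bound_linearization[where S = "cball x \<rho>"
          and f' = "\<lambda>x' v. v \<bullet> g x'"])
      fix t :: real assume "t \<in> {0..1}"
      thus "x + t *\<^sub>R (x - \<eta> *\<^sub>R d - x) \<in> cball x \<rho>"
        by (auto simp: \<rho>_def dist_norm abs_mult mult.assoc intro!: mult_left_le_one_le)
    next
      fix x' assume "x' \<in> cball x \<rho>"
      thus "(f has_derivative (\<lambda>v. v \<bullet> g x')) (at x' within cball x \<rho>)"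
        using deriv near(1) by (auto simp: gderiv_def intro: has_derivative_at_withinI)
    next
      fix x' assume x': "x' \<in> cball x \<rho>"
      have "norm (g x' - g x) \<le> C * norm (x' - x)"
        using lip near(2) x' by blast
      also have "\<dots> \<le> \<bar>C\<bar> * \<rho>"
        using x' by (intro mult_mono) (auto simp: dist_norm norm_minus_commute)
      finally have le: "norm (g x' - g x) \<le> \<bar>C\<bar> * \<rho>" .
      show "onorm ((\<lambda>v. v \<bullet> g x') - (\<lambda>v. v \<bullet> g x)) \<le> \<bar>C\<bar> * \<rho>"
      proof (rule onorm_bound)
        fix v
        have "norm (v \<bullet> g x' - v \<bullet> g x) \<le> norm v * norm (g x' - g x)"
          by (simp add: Cauchy_Schwarz_ineq2 flip: inner_diff_right)
        also have "\<dots> \<le> norm v * (\<bar>C\<bar> * \<rho>)"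
          using le by (intro mult_left_mono) auto
        finally show "norm (((\<lambda>v. v \<bullet> g x') - (\<lambda>v. v \<bullet> g x)) v) \<le> \<bar>C\<bar> * \<rho> * norm v"
          by (simp add: mult_ac)
      qed (simp add: \<rho>_def)
    qed (auto simp: \<rho>_def)
    thus ?case
      by (simp add: \<rho>_def inner_commute power2_eq_square abs_mult mult_ac del: abs_mult_self_eq)
  qed
  thus ?thesis
    by (rule bigoI)
qed

lemma has_smooth_gradient_vec_nth:
  assumes "twice_differentiable_at z \<theta>"
  shows "has_smooth_gradient (\<lambda>\<theta>. z \<theta> $ v) (\<lambda>\<theta>. jacobian z (at \<theta>) $ v) \<theta>"
  unfolding has_smooth_gradient_def
proof
  have "\<forall>\<^sub>F \<theta>' in nhds \<theta>. z differentiable (at \<theta>')"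
    using assms by (simp add: twice_differentiable_at_def)
  thus "\<forall>\<^sub>F \<theta>' in nhds \<theta>. GDERIV (\<lambda>\<theta>. z \<theta> $ v) \<theta>' :> jacobian z (at \<theta>') $ v"
  proof eventually_elim
    case (elim \<theta>')
    hence "(z has_derivative (\<lambda>d. jacobian z (at \<theta>') *v d)) (at \<theta>')"
      by (simp add: jacobian_works)
    hence "((\<lambda>\<theta>. z \<theta> $ v) has_derivative (\<lambda>d. (jacobian z (at \<theta>') *v d) $ v)) (at \<theta>')"
      by (rule bounded_linear.has_derivative[OF bounded_linear_vec_nth])
    thus ?case
      by (simp add: gderiv_def matrix_vector_mul_component inner_commute)
  qed
next
  show "(\<lambda>\<theta>. jacobian z (at \<theta>) $ v) differentiable (at \<theta>)"
    using assms bounded_linear.has_derivative[OF bounded_linear_vec_nth]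
    unfolding twice_differentiable_at_def differentiable_def by blast
qed

lemma softmax_pos: "softmax z $ v > 0"
  by (auto simp: softmax_def intro!: divide_pos_pos sum_pos)

lemma ln_softmax: "ln (softmax z $ v) = z $ v - ln (\<Sum>w\<in>UNIV. exp (z $ w))"
proof -
  have "(\<Sum>w\<in>UNIV. exp (z $ w)) > 0"
    by (intro sum_pos) auto
  thus ?thesis
    by (simp add: softmax_def ln_div)
qed

lemma has_smooth_gradient_ln_softmax:
  assumes "twice_differentiable_at z \<theta>"
  shows "has_smooth_gradient (\<lambda>\<theta>. ln (softmax (z \<theta>) $ v))
    (\<lambda>\<theta>. (axis v 1 - softmax (z \<theta>)) v* jacobian z (at \<theta>)) \<theta>"
proof -
  have "(axis v 1 - softmax a) v* J =
      J $ v - (\<Sum>w\<in>UNIV. (exp (a $ w) / (\<Sum>j\<in>UNIV. exp (a $ j))) *\<^sub>R J $ w)"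
    for a and J :: "real^'a^'b"
    by (simp add: vec_eq_iff vector_matrix_mult_def softmax_def axis_def algebra_simps
        sum_subtractf if_distrib[of "\<lambda>x. _ * x"] cong: if_cong)
  thus ?thesis
    unfolding ln_softmax
    using has_smooth_gradient_diff[OF has_smooth_gradient_vec_nth
        has_smooth_gradient_ln_sum_exp[where f = "\<lambda>w \<theta>. z \<theta> $ w", OF _ _ has_smooth_gradient_vec_nth],
        OF assms _ _ assms, of UNIV v]
    by simp
qed

lemma gen_lik_pos: "gen_lik h \<theta> y x > 0"
  by (auto simp: gen_lik_def intro!: prod_pos softmax_pos)

lemma ln_gen_lik: "ln (gen_lik h \<theta> y x) = (\<Sum>k<length x. ln (softmax (gen_logits h \<theta> y x k) $ (x ! k)))"
  unfolding gen_lik_def by (rule ln_prod) (auto simp: softmax_pos less_imp_neq[THEN not_sym])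

definition gen_score ::
  "('p::finite, 'v::finite) network \<Rightarrow> 'v list \<Rightarrow> 'v list \<Rightarrow> real^'p \<Rightarrow> real^'p" where
  "gen_score h y x \<theta> = (\<Sum>k<length x.
     (axis (x ! k) 1 - softmax (gen_logits h \<theta> y x k)) v*
     jacobian (\<lambda>\<theta>. gen_logits h \<theta> y x k) (at \<theta>))"

lemma has_smooth_gradient_ln_gen_lik:
  assumes "\<And>s j. j < length s \<Longrightarrow> twice_differentiable_at (\<lambda>\<theta>'. h \<theta>' s j) \<theta>"
  shows "has_smooth_gradient (\<lambda>\<theta>. ln (gen_lik h \<theta> y x)) (gen_score h y x) \<theta>"
  unfolding ln_gen_lik gen_score_def
  by (intro has_smooth_gradient_sum has_smooth_gradient_ln_softmax)
     (auto simp: gen_logits_def intro!: assms)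

lemma sft_step_eq:
  assumes "\<And>s j. j < length s \<Longrightarrow> twice_differentiable_at (\<lambda>\<theta>'. h \<theta>' s j) \<theta>"
  shows "sft_step h y x \<eta> \<theta> = \<theta> - \<eta> *\<^sub>R (- gen_score h y x \<theta>)"
proof -
  have "sft_loss h y x = (\<lambda>\<theta>. - ln (gen_lik h \<theta> y x))"
    by (simp add: sft_loss_def ln_gen_lik fun_eq_iff)
  moreover have "GDERIV (\<lambda>\<theta>. - ln (gen_lik h \<theta> y x)) \<theta> :> - gen_score h y x \<theta>"
    by (intro GDERIV_minus has_smooth_gradient_GDERIV has_smooth_gradient_ln_gen_lik assms)
  ultimately show ?thesis
    by (simp add: sft_step_def gradient_eqI)
qed

lemma vector_matrix_mult_inner:
  fixes A :: "real^'p^'v" and B :: "real^'p^'w"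
  shows "(a v* A) \<bullet> (b v* B) = (a v* (A ** transpose B)) \<bullet> b"
proof -
  have "(a v* A) \<bullet> (b v* B) = b \<bullet> (B *v (a v* A))"
    by (subst inner_commute) (rule dot_lmul_matrix)
  also have "B *v (a v* A) = a v* (A ** transpose B)"
    by (simp flip: vector_matrix_mul_assoc)
  finally show ?thesis
    by (simp only: inner_commute)
qed

lemma gen_score_inner:
  "gen_score h y x \<theta> \<bullet> (- gen_score h y' x' \<theta>) = (\<Sum>k<length x. \<Sum>r<length x'.
     ((axis (x ! k) 1 - softmax (gen_logits h \<theta> y x k)) v* entk h \<theta> y x k y' x' r)
     \<bullet> (softmax (gen_logits h \<theta> y' x' r) - axis (x' ! r) 1))"
  unfolding gen_score_def inner_minus_right inner_sum_left inner_sum_right entk_def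
    vector_matrix_mult_inner
  by (subst sum.swap) (simp flip: sum_negf inner_minus_right)

lemma und_lik_bayes:
  assumes coh: "coherent_branches h M P \<theta>" and P: "finite P" "y \<in> P" and x: "length x = M"
  shows "und_lik h \<theta> x y = gen_lik h \<theta> y x / (\<Sum>y'\<in>P. gen_lik h \<theta> y' x)"
proof -
  from coh obtain J :: "('b list \<times> 'b list) pmf" where
    fst: "map_pmf fst J = pmf_of_set P" and
    gen: "\<And>y. y \<in> P \<Longrightarrow> pmf J (y, x) = pmf (map_pmf fst J) y * gen_lik h \<theta> y x" and
    und: "pmf J (y, x) = pmf (map_pmf snd J) x * und_lik h \<theta> x y"
    unfolding coherent_branches_def using P x by blast
  have gen': "pmf J (y, x) = gen_lik h \<theta> y x / card P" if "y \<in> P" for y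
    using gen[OF that] P that unfolding fst by (subst (asm) pmf_of_set) auto
  have supp: "set_pmf J \<subseteq> P \<times> UNIV"
  proof -
    have "fst ` set_pmf J = P"
      using fst P by (metis empty_iff set_map_pmf set_pmf_of_set)
    thus ?thesis by force
  qed
  have "pmf (map_pmf snd J) x = measure (measure_pmf J) (snd -` {x})"
    by (rule pmf_map)
  also have "\<dots> = measure (measure_pmf J) ((\<lambda>y. (y, x)) ` P)"
    using supp by (intro measure_pmf.finite_measure_eq_AE) (auto intro!: AE_pmfI)
  also have "\<dots> = (\<Sum>y\<in>P. pmf J (y, x))"
    using P by (subst measure_measure_pmf_finite) (auto simp: sum.reindex inj_on_def)
  also have "\<dots> = (\<Sum>y\<in>P. gen_lik h \<theta> y x) / card P"
    by (simp add: gen' sum_divide_distrib)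
  finally have snd: "pmf (map_pmf snd J) x = (\<Sum>y\<in>P. gen_lik h \<theta> y x) / card P" .
  have "(\<Sum>y\<in>P. gen_lik h \<theta> y x) > 0" "card P > 0"
    using P by (auto intro!: sum_pos gen_lik_pos simp: card_gt_0_iff)
  thus ?thesis
    using und gen'[OF \<open>y \<in> P\<close>] unfolding snd by (simp add: field_simps)
qed

lemma weighted_sum_cancel:
  fixes w :: "'a \<Rightarrow> real" and g :: "'a \<Rightarrow> 'b::real_vector"
  assumes "finite P" "a \<in> P" "(\<Sum>i\<in>P. w i) = 1"
  shows "g a - (\<Sum>i\<in>P. w i *\<^sub>R g i) = (\<Sum>i\<in>P - {a}. w i *\<^sub>R (g a - g i))"
proof -
  have "g a - (\<Sum>i\<in>P. w i *\<^sub>R g i) = (\<Sum>i\<in>P. w i *\<^sub>R (g a - g i))"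
    using assms(3) by (simp add: scaleR_diff_right sum_subtractf flip: scaleR_sum_left)
  also have "\<dots> = (\<Sum>i\<in>P - {a}. w i *\<^sub>R (g a - g i))"
    using assms by (intro sum.mono_neutral_right) auto
  finally show ?thesis .
qed

lemma has_smooth_gradient_ln_posterior:
  assumes "\<And>s j. j < length s \<Longrightarrow> twice_differentiable_at (\<lambda>\<theta>'. h \<theta>' s j) \<theta>"
    and P: "finite P" "y \<in> P"
  shows "has_smooth_gradient
    (\<lambda>\<theta>. ln (gen_lik h \<theta> y x) - ln (\<Sum>y'\<in>P. gen_lik h \<theta> y' x))
    (\<lambda>\<theta>. \<Sum>y'\<in>P - {y}. prompt_weight h P \<theta> x y' *\<^sub>R (gen_score h y x \<theta> - gen_score h y' x \<theta>)) \<theta>"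
proof -
  have "(\<Sum>y'\<in>P. gen_lik h \<theta> y' x) > 0" for \<theta>
    using P by (auto intro!: sum_pos gen_lik_pos)
  hence "(\<Sum>y'\<in>P. prompt_weight h P \<theta> x y') = 1" for \<theta>
    unfolding prompt_weight_def by (simp add: less_imp_neq[THEN not_sym] flip: sum_divide_distrib)
  note cancel = weighted_sum_cancel[OF P this, of "\<lambda>y. gen_score h y x _", symmetric]
  have "P \<noteq> {}" using P by auto
  from has_smooth_gradient_diff[OF has_smooth_gradient_ln_gen_lik
      has_smooth_gradient_ln_sum_exp[OF P(1) this has_smooth_gradient_ln_gen_lik], OF assms(1) assms(1)]
  show ?thesis
    unfolding cancel by (simp add: prompt_weight_def gen_lik_pos)
qed

theorem proposition1:
  fixes h :: "('p::finite, 'v::finite) network"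
    and \<theta> :: "real^'p"
    and M :: nat
    and P :: "'v list set"
    and y\<^sub>0 x\<^sub>0 y\<^sub>u x\<^sub>u :: "'v list"
  assumes causal: "causal h"
    and smooth: "\<And>s j. j < length s \<Longrightarrow> twice_differentiable_at (\<lambda>\<theta>'. h \<theta>' s j) \<theta>"
    and prompts: "finite P" "y\<^sub>0 \<in> P" "y\<^sub>u \<in> P"
    and images: "length x\<^sub>0 = M" "length x\<^sub>u = M"
  shows
    "(\<lambda>\<eta>. delta_gen h \<theta> (sft_step h y\<^sub>u x\<^sub>u \<eta> \<theta>) y\<^sub>0 x\<^sub>0
        - (- \<eta> * (\<Sum>k<M. \<Sum>r<M.
             ((axis (x\<^sub>0 ! k) 1 - softmax (gen_logits h \<theta> y\<^sub>0 x\<^sub>0 k))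
                  v* entk h \<theta> y\<^sub>0 x\<^sub>0 k y\<^sub>u x\<^sub>u r)
             \<bullet> (softmax (gen_logits h \<theta> y\<^sub>u x\<^sub>u r) - axis (x\<^sub>u ! r) 1))))
      \<in> O[at 0](\<lambda>\<eta>. \<eta>\<^sup>2)
    \<and>
    ((\<forall>\<^sub>F \<theta>' in nhds \<theta>. coherent_branches h M P \<theta>') \<longrightarrow>
     (\<lambda>\<eta>. delta_und h \<theta> (sft_step h y\<^sub>u x\<^sub>u \<eta> \<theta>) x\<^sub>0 y\<^sub>0
        - (- \<eta> * (\<Sum>k<M. \<Sum>r<M. \<Sum>y\<^sub>i\<in>P - {y\<^sub>0}.
             prompt_weight h P \<theta> x\<^sub>0 y\<^sub>i *
             (((axis (x\<^sub>0 ! k) 1 - softmax (gen_logits h \<theta> y\<^sub>0 x\<^sub>0 k))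
                  v* entk h \<theta> y\<^sub>0 x\<^sub>0 k y\<^sub>u x\<^sub>u r
               - (axis (x\<^sub>0 ! k) 1 - softmax (gen_logits h \<theta> y\<^sub>i x\<^sub>0 k))
                  v* entk h \<theta> y\<^sub>i x\<^sub>0 k y\<^sub>u x\<^sub>u r)
              \<bullet> (softmax (gen_logits h \<theta> y\<^sub>u x\<^sub>u r) - axis (x\<^sub>u ! r) 1)))))
      \<in> O[at 0](\<lambda>\<eta>. \<eta>\<^sup>2))"
proof (intro conjI impI)
  have score: "has_smooth_gradient (\<lambda>\<theta>. ln (gen_lik h \<theta> y x)) (gen_score h y x) \<theta>" for y x
    by (intro has_smooth_gradient_ln_gen_lik smooth)
  let ?d = "- gen_score h y\<^sub>u x\<^sub>u \<theta>"
  have step: "sft_step h y\<^sub>u x\<^sub>u \<eta> \<theta> = \<theta> - \<eta> *\<^sub>R ?d" for \<eta>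
    by (rule sft_step_eq[OF smooth])
  show "(\<lambda>\<eta>. delta_gen h \<theta> (sft_step h y\<^sub>u x\<^sub>u \<eta> \<theta>) y\<^sub>0 x\<^sub>0
        - (- \<eta> * (\<Sum>k<M. \<Sum>r<M.
             ((axis (x\<^sub>0 ! k) 1 - softmax (gen_logits h \<theta> y\<^sub>0 x\<^sub>0 k))
                  v* entk h \<theta> y\<^sub>0 x\<^sub>0 k y\<^sub>u x\<^sub>u r)
             \<bullet> (softmax (gen_logits h \<theta> y\<^sub>u x\<^sub>u r) - axis (x\<^sub>u ! r) 1))))
      \<in> O[at 0](\<lambda>\<eta>. \<eta>\<^sup>2)"
    using has_smooth_gradient_taylor[OF score[of y\<^sub>0 x\<^sub>0], of ?d]
    unfolding delta_gen_def step gen_score_inner images .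

  assume coh: "\<forall>\<^sub>F \<theta>' in nhds \<theta>. coherent_branches h M P \<theta>'"
  let ?f = "\<lambda>\<theta>. ln (gen_lik h \<theta> y\<^sub>0 x\<^sub>0) - ln (\<Sum>y\<in>P. gen_lik h \<theta> y x\<^sub>0)"
  let ?S = "\<Sum>k<M. \<Sum>r<M. \<Sum>y\<^sub>i\<in>P - {y\<^sub>0}.
             prompt_weight h P \<theta> x\<^sub>0 y\<^sub>i *
             (((axis (x\<^sub>0 ! k) 1 - softmax (gen_logits h \<theta> y\<^sub>0 x\<^sub>0 k))
                  v* entk h \<theta> y\<^sub>0 x\<^sub>0 k y\<^sub>u x\<^sub>u r
               - (axis (x\<^sub>0 ! k) 1 - softmax (gen_logits h \<theta> y\<^sub>i x\<^sub>0 k))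
                  v* entk h \<theta> y\<^sub>i x\<^sub>0 k y\<^sub>u x\<^sub>u r)
              \<bullet> (softmax (gen_logits h \<theta> y\<^sub>u x\<^sub>u r) - axis (x\<^sub>u ! r) 1))"
  have sum_swap: "(\<Sum>k<M. \<Sum>r<M. \<Sum>y\<in>Q. F k r y) = (\<Sum>y\<in>Q. \<Sum>k<M. \<Sum>r<M. F k r y)"
    for F :: "nat \<Rightarrow> nat \<Rightarrow> 'v list \<Rightarrow> real" and Q
    by (simp only: sum.swap[of _ Q])
  have S: "(\<Sum>y\<in>P - {y\<^sub>0}. prompt_weight h P \<theta> x\<^sub>0 y *\<^sub>R
      (gen_score h y\<^sub>0 x\<^sub>0 \<theta> - gen_score h y x\<^sub>0 \<theta>)) \<bullet> ?d = ?S"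
    unfolding sum_swap inner_sum_left inner_scaleR_left inner_diff_left gen_score_inner images
    by (simp add: sum_distrib_left sum_subtractf right_diff_distrib)
  have posterior: "has_smooth_gradient ?f (\<lambda>\<theta>. \<Sum>y\<in>P - {y\<^sub>0}. prompt_weight h P \<theta> x\<^sub>0 y *\<^sub>R
      (gen_score h y\<^sub>0 x\<^sub>0 \<theta> - gen_score h y x\<^sub>0 \<theta>)) \<theta>"
    by (intro has_smooth_gradient_ln_posterior smooth prompts)
  have ln_und: "ln (und_lik h \<theta>' x\<^sub>0 y\<^sub>0) = ?f \<theta>'" if "coherent_branches h M P \<theta>'" for \<theta>'
  proof -
    have "(\<Sum>y\<in>P. gen_lik h \<theta>' y x\<^sub>0) > 0"
      using prompts by (auto intro!: sum_pos gen_lik_pos)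
    thus ?thesis
      using und_lik_bayes[OF that prompts(1,2) images(1)] gen_lik_pos[of h \<theta>' y\<^sub>0 x\<^sub>0]
      by (simp add: ln_div)
  qed
  have "((\<lambda>\<eta>. \<theta> - \<eta> *\<^sub>R ?d) \<longlongrightarrow> \<theta> - 0 *\<^sub>R ?d) (at 0)"
    by (intro tendsto_intros)
  hence "\<forall>\<^sub>F \<eta> in at 0. coherent_branches h M P (\<theta> - \<eta> *\<^sub>R ?d)"
    using coh by (simp add: filterlim_iff)
  hence "\<forall>\<^sub>F \<eta> in at 0. ?f (\<theta> - \<eta> *\<^sub>R ?d) - ?f \<theta> - (- \<eta> * ?S)
      = delta_und h \<theta> (sft_step h y\<^sub>u x\<^sub>u \<eta> \<theta>) x\<^sub>0 y\<^sub>0 - (- \<eta> * ?S)"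
    by eventually_elim
       (simp only: delta_und_def step ln_und ln_und[OF eventually_nhds_x_imp_x[OF coh]])
  from landau_o.big.in_cong[OF this]
  show "(\<lambda>\<eta>. delta_und h \<theta> (sft_step h y\<^sub>u x\<^sub>u \<eta> \<theta>) x\<^sub>0 y\<^sub>0 - (- \<eta> * ?S)) \<in> O[at 0](\<lambda>\<eta>. \<eta>\<^sup>2)"
    using has_smooth_gradient_taylor[OF posterior, of ?d]
    unfolding S by blast
qed

end
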